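(* (i) Two isosceles triangles $\Delta$ and $\Delta'$ are equisectionally equivalent if and only if either they are similar or their base angles $\theta$ (of $\Delta$) and $\theta'$ (of $\Delta'$) satisfy $\tan\theta\cdot\tan\theta'=3$. (ii) Let $\Delta$ and $\Delta'$ be equisectionally equivalent isosceles triangles with $[\Delta]\neq[\Delta']$. Then, for $q\in\mathbb{R}$, $[T_q(\Delta)]=[\Delta']$ if and only if $q=1/3$ or $q=2/3$. (iii) Every triangle is equisectionally equivalent to some isosceles triangle.
   Context: Triangles are nondegenerate triangles in the Euclidean plane $\cong\mathbb{C}$. Two triangles are called similar if some orientation-preserving similarity of the plane carries one onto the other (labels of vertices need not be matched); $[\Delta]$ denotes the similarity class of $\Delta$. Regular triangles count as isosceles. Equisection operators: for $q\in\mathbb{R}$ and a triangle $\triangle ABC$ with vertices listed anticlockwise, $T_q(\triangle ABC)=\triangle A'B'C'$ where $A'=qB+(1-q)C$, $B'=qC+(1-q)A$, $C'=qA+(1-q)B$. Equisectional equivalence is the equivalence relation on the set of triangles generated by similarity and $\{T_q\}_{q\in\mathbb{R}}$. *)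

theory Defs
  imports "HOL-Analysis.Analysis"
begin

text \<open>A triangle is represented by its set of vertices in the complex plane, so that it
  carries no labelling.\<close>

definition is_triangle :: "complex set \<Rightarrow> bool" where
  "is_triangle \<Delta> \<longleftrightarrow> (\<exists>A B C. \<Delta> = {A, B, C} \<and> \<not> collinear {A, B, C})"

text \<open>Orientation-preserving similarities of the plane are the maps
  \<open>z \<mapsto> a z + b\<close> with \<open>a \<noteq> 0\<close>.\<close>

definition similar :: "complex set \<Rightarrow> complex set \<Rightarrow> bool" where
  "similar \<Delta> \<Delta>' \<longleftrightarrow> (\<exists>a b. a \<noteq> 0 \<and> \<Delta>' = (\<lambda>z. a * z + b) ` \<Delta>)"

definition sim_class :: "complex set \<Rightarrow> complex set set" where
  "sim_class \<Delta> = {\<Delta>'. is_triangle \<Delta>' \<and> similar \<Delta> \<Delta>'}"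

text \<open>The condition says that \<open>C\<close> lies strictly to the left of the line directed from
  \<open>A\<close> to \<open>B\<close>; it also forces \<open>A \<noteq> B\<close>, as division by zero yields zero.\<close>

definition anticlockwise :: "complex \<Rightarrow> complex \<Rightarrow> complex \<Rightarrow> bool" where
  "anticlockwise A B C \<longleftrightarrow> Im ((C - A) / (B - A)) > 0"

text \<open>The three vertices of the new triangle arise from the three anticlockwise listings of
  the vertices of \<open>\<Delta>\<close>, which are cyclic shifts of each other; see
  \<open>equisect_eq\<close> below.\<close>

definition equisect :: "real \<Rightarrow> complex set \<Rightarrow> complex set" where
  "equisect q \<Delta> =
     {of_real q * B + of_real (1 - q) * C | A B C. \<Delta> = {A, B, C} \<and> anticlockwise A B C}"

definition equisectionally_equivalent :: "complex set \<Rightarrow> complex set \<Rightarrow> bool" where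
  "equisectionally_equivalent =
     equivclp (\<lambda>\<Delta> \<Delta>'. is_triangle \<Delta> \<and> is_triangle \<Delta>' \<and>
       (similar \<Delta> \<Delta>' \<or> (\<exists>q. \<Delta>' = equisect q \<Delta>)))"

definition vertex_angle :: "complex \<Rightarrow> complex \<Rightarrow> complex \<Rightarrow> real" where
  "vertex_angle A B C = arccos (((A - B) \<bullet> (C - B)) / (norm (A - B) * norm (C - B)))"

definition isosceles :: "complex set \<Rightarrow> bool" where
  "isosceles \<Delta> \<longleftrightarrow> (\<exists>A B C. \<Delta> = {A, B, C} \<and> \<not> collinear {A, B, C} \<and> dist A B = dist A C)"

text \<open>A relation rather than a function, because a regular triangle has three choices of apex
  (each giving the same angle).\<close>

definition base_angle :: "complex set \<Rightarrow> real \<Rightarrow> bool" where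
  "base_angle \<Delta> \<theta> \<longleftrightarrow>
     (\<exists>A B C. \<Delta> = {A, B, C} \<and> \<not> collinear {A, B, C} \<and> dist A B = dist A C \<and>
       \<theta> = vertex_angle A B C)"

lemma anticlockwise_iff:
  "anticlockwise A B C \<longleftrightarrow>
     (Re B - Re A) * (Im C - Im A) - (Im B - Im A) * (Re C - Re A) > 0"
proof -
  have "Im ((C - A) / (B - A)) =
    ((Re B - Re A) * (Im C - Im A) - (Im B - Im A) * (Re C - Re A)) / (cmod (B - A))\<^sup>2"
    by (simp add: Im_divide cmod_power2 algebra_simps)
  then show ?thesis
    unfolding anticlockwise_def
    by (cases "A = B") (auto simp: zero_less_divide_iff)
qed

lemma anticlockwise_rotate: "anticlockwise A B C \<longleftrightarrow> anticlockwise B C A"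
  by (simp add: anticlockwise_iff algebra_simps)

lemma anticlockwise_distinct: "anticlockwise A B C \<Longrightarrow> A \<noteq> B \<and> B \<noteq> C \<and> A \<noteq> C"
  by (auto simp: anticlockwise_iff algebra_simps)

lemma anticlockwise_listings:
  assumes "anticlockwise A B C"
  shows "{A, B, C} = {X, Y, Z} \<and> anticlockwise X Y Z \<longleftrightarrow>
    (X, Y, Z) \<in> {(A, B, C), (B, C, A), (C, A, B)}"
proof
  assume *: "{A, B, C} = {X, Y, Z} \<and> anticlockwise X Y Z"
  then have d: "X \<noteq> Y" "Y \<noteq> Z" "X \<noteq> Z"
    using anticlockwise_distinct by blast+
  have m: "X \<in> {A, B, C}" "Y \<in> {A, B, C}" "Z \<in> {A, B, C}"
    using * by auto
  show "(X, Y, Z) \<in> {(A, B, C), (B, C, A), (C, A, B)}"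
  proof -
    have neg: "\<not> anticlockwise A C B" "\<not> anticlockwise C B A" "\<not> anticlockwise B A C"
      using assms by (simp_all add: anticlockwise_iff algebra_simps)
    have "(X, Y, Z) \<in> {(A, B, C), (B, C, A), (C, A, B)} \<or>
        (X, Y, Z) \<in> {(A, C, B), (C, B, A), (B, A, C)}"
      using m d by (elim insertE emptyE) simp_all
    then show ?thesis
      using neg * by blast
  qed
next
  assume "(X, Y, Z) \<in> {(A, B, C), (B, C, A), (C, A, B)}"
  then show "{A, B, C} = {X, Y, Z} \<and> anticlockwise X Y Z"
    using assms anticlockwise_rotate by auto
qed

lemma equisect_eq:
  assumes "anticlockwise A B C"
  shows "equisect q {A, B, C} =
    {of_real q * B + of_real (1 - q) * C,
     of_real q * C + of_real (1 - q) * A,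
     of_real q * A + of_real (1 - q) * B}"
  unfolding equisect_def anticlockwise_listings[OF assms] by auto

lemma equisect_anticlockwise:
  assumes "anticlockwise A B C"
  shows "anticlockwise (of_real q * B + of_real (1 - q) * C)
    (of_real q * C + of_real (1 - q) * A) (of_real q * A + of_real (1 - q) * B)"
proof -
  define D where "D = (Re B - Re A) * (Im C - Im A) - (Im B - Im A) * (Re C - Re A)"
  have "D > 0"
    using assms by (simp add: anticlockwise_iff D_def)
  moreover have "3 * q\<^sup>2 - 3 * q + 1 = 3 * (q - 1/2)\<^sup>2 + 1/4"
    by (simp add: power2_eq_square algebra_simps)
  then have "3 * q\<^sup>2 - 3 * q + 1 > 0"
    using zero_le_power2[of "q - 1/2"] by linarith
  ultimately have "(3 * q\<^sup>2 - 3 * q + 1) * D > 0"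
    by simp
  then show ?thesis
    by (simp add: anticlockwise_iff D_def power2_eq_square algebra_simps)
qed

lemma not_collinear_iff:
  "\<not> collinear {A, B, C} \<longleftrightarrow> anticlockwise A B C \<or> anticlockwise A C B" for A B C :: complex
proof -
  let ?D = "(Re B - Re A) * (Im C - Im A) - (Im B - Im A) * (Re C - Re A)"
  have "collinear {A, B, C} \<longleftrightarrow> collinear {0, B - A, C - A}"
    using collinear_3[of B A C] by (simp add: insert_commute)
  also have "\<dots> \<longleftrightarrow> ((B - A) \<bullet> (C - A))\<^sup>2 = (norm (B - A))\<^sup>2 * (norm (C - A))\<^sup>2"
  proof -
    have "collinear {0, B - A, C - A} \<longleftrightarrow>
        \<bar>(B - A) \<bullet> (C - A)\<bar> = \<bar>norm (B - A) * norm (C - A)\<bar>"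
      by (simp add: norm_cauchy_schwarz_equal abs_mult)
    then show ?thesis
      unfolding power_mult_distrib[symmetric] abs_eq_iff power2_eq_iff .
  qed
  also have "(norm (B - A))\<^sup>2 * (norm (C - A))\<^sup>2 = ((B - A) \<bullet> (C - A))\<^sup>2 + ?D\<^sup>2"
    unfolding cmod_power2 inner_complex_def by (simp add: power2_eq_square algebra_simps)
  finally have "collinear {A, B, C} \<longleftrightarrow> ?D = 0"
    by simp
  then show ?thesis
    by (auto simp: anticlockwise_iff algebra_simps)
qed

lemma is_triangle_iff: "is_triangle \<Delta> \<longleftrightarrow> (\<exists>A B C. \<Delta> = {A, B, C} \<and> anticlockwise A B C)"
  unfolding is_triangle_def not_collinear_iff by (metis insert_commute)

lemma is_triangle_equisect: "is_triangle \<Delta> \<Longrightarrow> is_triangle (equisect q \<Delta>)"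
  unfolding is_triangle_iff using equisect_eq equisect_anticlockwise by blast

end

theory Submission
  imports Defs
begin

text \<open>The discrete Fourier transform on three points diagonalises equisection. The quotient
  \<open>\<rho>\<close> of the two non-constant Fourier coefficients of a labelled triangle is a
  complete similarity invariant, and relabelling cyclically multiplies it by a cube root of unity,
  so \<open>\<rho>\<^sup>3\<close> classifies unlabelled triangles. The operator \<open>T\<^sub>q\<close> multiplies
  \<open>\<rho>\<close> by \<open>(1 + i u) / (1 - i u)\<close> with \<open>u = sqrt 3 (2 q - 1)\<close>, a
  unimodular number, so \<open>\<bar>\<rho>\<bar>\<close> is invariant, and \<open>\<rho>\<close> can be rotated
  onto the real axis, where the isosceles triangles lie. An isosceles triangle with
  \<open>t = tan \<theta>\<close> has \<open>\<rho> = (t - sqrt 3) / (t + sqrt 3)\<close>; changing the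
  sign of \<open>\<rho>\<close> amounts to replacing \<open>t\<close> by \<open>3 / t\<close>.\<close>

section \<open>Fourier coefficients of labelled triangles\<close>

definition omega :: complex where
  "omega = Complex (-1/2) (sqrt 3 / 2)"

lemma omega_square: "omega\<^sup>2 = -1 - omega"
  by (simp add: omega_def complex_eq_iff power2_eq_square)

lemma omega_cube: "omega ^ 3 = 1"
  using omega_square by algebra

lemma omega_nonzero [simp]: "omega \<noteq> 0"
  using omega_cube by auto

text \<open>Of the two non-constant modes, this one survives on the anticlockwise regular triangle
  1, \<open>omega\<close>, \<open>omega\<^sup>2\<close>, where \<open>neg_coeff\<close>
  vanishes.\<close>

definition pos_coeff :: "complex \<Rightarrow> complex \<Rightarrow> complex \<Rightarrow> complex" where
  "pos_coeff A B C = A + omega\<^sup>2 * B + omega * C"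

definition neg_coeff :: "complex \<Rightarrow> complex \<Rightarrow> complex \<Rightarrow> complex" where
  "neg_coeff A B C = A + omega * B + omega\<^sup>2 * C"

definition distortion :: "complex \<Rightarrow> complex \<Rightarrow> complex \<Rightarrow> complex" where
  "distortion A B C = neg_coeff A B C / pos_coeff A B C"

lemma pos_coeff_differences: "pos_coeff A B C = omega * (omega * (B - A) + (C - A))"
  unfolding pos_coeff_def using omega_square by algebra

lemma neg_coeff_differences: "neg_coeff A B C = omega * ((B - A) + omega * (C - A))"
  unfolding neg_coeff_def using omega_square by algebra

text \<open>Only a clockwise regular or a degenerate triple lacks this mode, so
  \<open>distortion\<close> is a genuine quotient on anticlockwise listings.\<close>

lemma pos_coeff_nonzero:
  assumes "anticlockwise A B C"
  shows "pos_coeff A B C \<noteq> 0"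
proof
  assume "pos_coeff A B C = 0"
  then have "C - A = - omega * (B - A)"
    by (simp add: pos_coeff_differences eq_neg_iff_add_eq_0 add.commute)
  moreover have "A \<noteq> B"
    using assms anticlockwise_distinct by blast
  ultimately have "(C - A) / (B - A) = - omega"
    by (simp add: field_simps)
  then show False
    using assms by (simp add: anticlockwise_def omega_def)
qed

lemma distortion_rotate: "distortion B C A = omega * distortion A B C"
proof -
  have "neg_coeff B C A = omega\<^sup>2 * neg_coeff A B C" "pos_coeff B C A = omega * pos_coeff A B C"
    unfolding neg_coeff_def pos_coeff_def using omega_square by algebra+
  then show ?thesis
    by (simp add: distortion_def power2_eq_square)
qed

lemma distortion_affine:
  assumes "a \<noteq> 0"
  shows "distortion (a * A + b) (a * B + b) (a * C + b) = distortion A B C"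
proof -
  have "neg_coeff (a * A + b) (a * B + b) (a * C + b) = a * neg_coeff A B C"
    "pos_coeff (a * A + b) (a * B + b) (a * C + b) = a * pos_coeff A B C"
    unfolding neg_coeff_def pos_coeff_def using omega_square by algebra+
  then show ?thesis
    using assms by (simp add: distortion_def)
qed

section \<open>Classification of similarity classes\<close>

lemma anticlockwise_affine:
  "a \<noteq> 0 \<Longrightarrow> anticlockwise (a * A + b) (a * B + b) (a * C + b) = anticlockwise A B C"
  by (simp add: anticlockwise_def flip: right_diff_distrib)

lemma similar_if_distortion_eq:
  assumes "anticlockwise A B C" "anticlockwise A' B' C'"
    and "distortion A B C = distortion A' B' C'"
  shows "similar {A, B, C} {A', B', C'}"
proof -
  define a where "a = (B' - A') / (B - A)"
  have ne: "B - A \<noteq> 0" "B' - A' \<noteq> 0"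
    using anticlockwise_distinct[OF assms(1)] anticlockwise_distinct[OF assms(2)] by auto
  have "omega\<^sup>2 \<noteq> 1"
    by (simp only: omega_square) (simp add: omega_def complex_eq_iff)
  have "neg_coeff A B C * pos_coeff A' B' C' = neg_coeff A' B' C' * pos_coeff A B C"
    using assms(3) pos_coeff_nonzero[OF assms(1)] pos_coeff_nonzero[OF assms(2)]
    by (simp add: distortion_def frac_eq_eq)
  \<comment> \<open>Up to sign, 1 - \<open>omega\<^sup>2\<close> is the determinant of the Moebius
    map taking (C - A) / (B - A) to the distortion; as it is nonzero, that map is injective.\<close>
  then have "(1 - omega\<^sup>2) * ((B - A) * (C' - A') - (B' - A') * (C - A)) = 0"
    unfolding neg_coeff_differences pos_coeff_differences using omega_nonzero by algebra
  then have "(B - A) * (C' - A') = (B' - A') * (C - A)"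
    using \<open>omega\<^sup>2 \<noteq> 1\<close> by simp
  moreover have a: "a * (B - A) = B' - A'"
    using ne by (simp add: a_def)
  ultimately have "(B - A) * (C' - A') = (B - A) * (a * (C - A))"
    by algebra
  then have "C' - A' = a * (C - A)"
    using ne(1) by (metis mult_left_cancel)
  then have "C' = a * C + (A' - a * A)"
    by (simp add: algebra_simps)
  moreover have "B' = a * B + (A' - a * A)"
    using a by (simp add: algebra_simps)
  moreover have "A' = a * A + (A' - a * A)" "a \<noteq> 0"
    using ne by (simp_all add: a_def)
  ultimately show ?thesis
    unfolding similar_def by (intro exI[of _ a] exI[of _ "A' - a * A"]) auto
qed

lemma cube_eq_imp:
  assumes "x ^ 3 = y ^ 3"
  shows "x = y \<or> x = omega * y \<or> x = omega * (omega * y)"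
proof -
  have "(x - y) * ((x - omega * y) * (x - omega * (omega * y))) = 0"
    using assms omega_square by algebra
  then show ?thesis
    by simp
qed

text \<open>A similarity preserves orientation, so it maps an anticlockwise listing to one of three
  cyclic shifts, whose distortions differ by cube roots of unity. Conversely, equal cubes make the
  distortion agree with that of some shift.\<close>

lemma similar_iff_distortion:
  assumes "anticlockwise A B C" "anticlockwise A' B' C'"
  shows "similar {A, B, C} {A', B', C'} \<longleftrightarrow> distortion A B C ^ 3 = distortion A' B' C' ^ 3"
proof
  assume "similar {A, B, C} {A', B', C'}"
  then obtain a b where "a \<noteq> 0" and im: "{A', B', C'} = {a * A + b, a * B + b, a * C + b}"
    unfolding similar_def by auto
  have "anticlockwise (a * A + b) (a * B + b) (a * C + b)"
    using assms(1) \<open>a \<noteq> 0\<close> by (simp add: anticlockwise_affine)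
  then have "(a * A + b, a * B + b, a * C + b) \<in> {(A', B', C'), (B', C', A'), (C', A', B')}"
    using im anticlockwise_listings[OF assms(2)] by metis
  then have "distortion (a * A + b) (a * B + b) (a * C + b) ^ 3 = distortion A' B' C' ^ 3"
    using distortion_rotate[of B' C' A'] distortion_rotate[of C' A' B']
    by (auto simp: power_mult_distrib omega_cube)
  then show "distortion A B C ^ 3 = distortion A' B' C' ^ 3"
    using \<open>a \<noteq> 0\<close> by (simp add: distortion_affine)
next
  assume eq: "distortion A B C ^ 3 = distortion A' B' C' ^ 3"
  have "distortion A B C \<in> {distortion A' B' C', distortion B' C' A', distortion C' A' B'}"
    using cube_eq_imp[OF eq] by (simp add: distortion_rotate[of B' C' A'] distortion_rotate[of C' A' B'])
  moreover have "anticlockwise B' C' A'" "anticlockwise C' A' B'"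
    using assms(2) anticlockwise_rotate by blast+
  moreover have "{B', C', A'} = {A', B', C'}" "{C', A', B'} = {A', B', C'}"
    by auto
  ultimately show "similar {A, B, C} {A', B', C'}"
    using assms similar_if_distortion_eq by (elim insertE emptyE) metis+
qed

definition shape :: "complex set \<Rightarrow> complex" where
  "shape \<Delta> = (THE z. \<exists>A B C. \<Delta> = {A, B, C} \<and> anticlockwise A B C \<and> z = distortion A B C ^ 3)"

lemma similar_refl: "similar \<Delta> \<Delta>"
  unfolding similar_def by (intro exI[of _ 1] exI[of _ 0]) simp

lemma shape_eq:
  assumes "anticlockwise A B C"
  shows "shape {A, B, C} = distortion A B C ^ 3"
  unfolding shape_def
proof (rule the_equality)
  fix z assume "\<exists>A' B' C'. {A, B, C} = {A', B', C'} \<and> anticlockwise A' B' C' \<and> z = distortion A' B' C' ^ 3"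
  then show "z = distortion A B C ^ 3"
    \<comment> \<open>Well-definedness is the similarity criterion for two listings of the same
      triangle.\<close>
    using similar_refl[of "{A, B, C}"] similar_iff_distortion[OF assms] by metis
qed (use assms in blast)

lemma similar_iff_shape:
  assumes "is_triangle \<Delta>" "is_triangle \<Delta>'"
  shows "similar \<Delta> \<Delta>' \<longleftrightarrow> shape \<Delta> = shape \<Delta>'"
  using assms unfolding is_triangle_iff by (auto simp: similar_iff_distortion shape_eq)

lemma sim_class_eq_iff_shape:
  assumes "is_triangle \<Delta>" "is_triangle \<Delta>'"
  shows "sim_class \<Delta> = sim_class \<Delta>' \<longleftrightarrow> shape \<Delta> = shape \<Delta>'"
proof -
  have "sim_class X = {Y. is_triangle Y \<and> shape X = shape Y}" if "is_triangle X" for X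
    using that by (auto simp: sim_class_def similar_iff_shape)
  then show ?thesis
    using assms by auto
qed

section \<open>Action of equisection on shapes\<close>

text \<open>Proportional, with factor \<open>-2\<close>, to the eigenvalue \<open>q \<omega>\<^sup>2 + (1 - q) \<omega>\<close>
  of \<open>T\<^sub>q\<close> on \<open>neg_coeff\<close>; on \<open>pos_coeff\<close> the eigenvalue is its conjugate.\<close>

definition twist :: "real \<Rightarrow> complex" where
  "twist q = Complex 1 (sqrt 3 * (2 * q - 1))"

lemma twist_nonzero: "twist q \<noteq> 0"
  by (simp add: twist_def complex_eq_iff)

text \<open>\<open>T\<^sub>q\<close> is a linear combination of the two nontrivial cyclic shifts,
  and the Fourier coefficients are eigenvectors of both.\<close>

lemma distortion_equisect:
  "distortion (of_real q * B + of_real (1 - q) * C) (of_real q * C + of_real (1 - q) * A)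
     (of_real q * A + of_real (1 - q) * B) = twist q / cnj (twist q) * distortion A B C"
  (is "distortion ?A ?B ?C = _")
proof -
  let ?q = "complex_of_real q"
  define k k' where "k = ?q * omega\<^sup>2 + (1 - ?q) * omega" and "k' = ?q * omega + (1 - ?q) * omega\<^sup>2"
  have "twist q = -2 * k" "cnj (twist q) = -2 * k'"
    unfolding k_def k'_def omega_square
    by (simp_all add: twist_def omega_def complex_eq_iff algebra_simps)
  then have "twist q / cnj (twist q) = k / k'"
    by simp
  moreover have "neg_coeff ?A ?B ?C = k * neg_coeff A B C" "pos_coeff ?A ?B ?C = k' * pos_coeff A B C"
    unfolding neg_coeff_def pos_coeff_def k_def k'_def of_real_diff of_real_1
    using omega_square by algebra+
  ultimately show ?thesis
    by (simp add: distortion_def)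
qed

lemma shape_equisect:
  assumes "is_triangle \<Delta>"
  shows "shape (equisect q \<Delta>) = (twist q / cnj (twist q)) ^ 3 * shape \<Delta>"
proof -
  obtain A B C where \<Delta>: "\<Delta> = {A, B, C}" and abc: "anticlockwise A B C"
    using assms is_triangle_iff by blast
  show ?thesis
    unfolding \<Delta> equisect_eq[OF abc] shape_eq[OF abc]
      shape_eq[OF equisect_anticlockwise[OF abc]] distortion_equisect power_mult_distrib ..
qed

text \<open>The condition says that the cube of 1 + i u is purely imaginary, where u = sqrt 3 (2 q -
  1). This means 3 u^2 = 1, that is, 2 q - 1 = 1/3 or -1/3.\<close>

lemma twist_ratio_cube_eq_minus_one: "(twist q / cnj (twist q)) ^ 3 = -1 \<longleftrightarrow> q = 1/3 \<or> q = 2/3"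
proof -
  have "(twist q / cnj (twist q)) ^ 3 = -1 \<longleftrightarrow> twist q ^ 3 = - (cnj (twist q) ^ 3)"
    using twist_nonzero[of q] by (simp add: power_divide divide_eq_eq)
  also have "\<dots> \<longleftrightarrow> twist q ^ 3 + cnj (twist q ^ 3) = 0"
    by (simp add: eq_neg_iff_add_eq_0)
  also have "\<dots> \<longleftrightarrow> Re (twist q ^ 3) = 0"
    by (simp add: complex_eq_iff del: complex_cnj_power)
  also have "Re (twist q ^ 3) = 1 - 3 * (sqrt 3 * (2 * q - 1))\<^sup>2"
    by (simp only: twist_def power3_eq_cube power2_eq_square) simp
  also have "\<dots> = -36 * ((q - 1/3) * (q - 2/3))"
    by (simp add: power_mult_distrib) (simp add: power2_eq_square field_simps)
  finally show ?thesis
    by simp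
qed

text \<open>Similarity fixes the shape and \<open>T\<^sub>q\<close> multiplies it by a unimodular
  number; equality of norms then passes along generating steps in either direction.\<close>

lemma norm_shape_invariant:
  assumes "equisectionally_equivalent \<Delta> \<Delta>'"
  shows "norm (shape \<Delta>) = norm (shape \<Delta>')"
proof -
  have step: "norm (shape X) = norm (shape Y)"
    if "is_triangle X \<and> is_triangle Y \<and> (similar X Y \<or> (\<exists>q. Y = equisect q X))" for X Y
    using that
    by (auto simp: similar_iff_shape shape_equisect norm_mult norm_power norm_divide twist_nonzero)
  show ?thesis
    using assms unfolding equisectionally_equivalent_def
    by (induction rule: equivclp_induct) (simp, metis step)
qed

lemma equisectionally_equivalent_trans:
  "equisectionally_equivalent X Y \<Longrightarrow> equisectionally_equivalent Y Z \<Longrightarrow> equisectionally_equivalent X Z"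
  unfolding equisectionally_equivalent_def by (rule equivclp_trans)

lemma equisectionally_equivalent_similar:
  "is_triangle X \<Longrightarrow> is_triangle Y \<Longrightarrow> similar X Y \<Longrightarrow> equisectionally_equivalent X Y"
  unfolding equisectionally_equivalent_def by (rule r_into_equivclp) simp

lemma equisectionally_equivalent_equisect:
  "is_triangle X \<Longrightarrow> equisectionally_equivalent X (equisect q X)"
  unfolding equisectionally_equivalent_def
  by (rule r_into_equivclp) (auto simp: is_triangle_equisect)

section \<open>Reaching an isosceles triangle\<close>

lemma isosceles_if_distortion_real:
  assumes "anticlockwise A B C" "Im (distortion A B C) = 0"
  shows "isosceles {A, B, C}"
proof -
  define p r where "p = B - A" and "r = C - A"
  \<comment> \<open>A quotient is real when numerator times conjugate denominator is. The mixed
    terms of this product add up to a real number, leaving only the difference of the squared sides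
    at A.\<close>
  have "Im ((omega * (p + omega * r)) * cnj (omega * (omega * p + r))) = 0"
    using assms(2)
    by (simp only: distortion_def neg_coeff_differences pos_coeff_differences p_def r_def
        Im_complex_div_eq_0)
  also have "(omega * (p + omega * r)) * cnj (omega * (omega * p + r))
      = (omega * cnj omega) * ((p + omega * r) * cnj (omega * p + r))"
    by (simp add: algebra_simps)
  also have "omega * cnj omega = 1"
    by (simp add: omega_def complex_eq_iff)
  also have "Im (1 * ((p + omega * r) * cnj (omega * p + r))) = sqrt 3 / 2 * ((norm r)\<^sup>2 - (norm p)\<^sup>2)"
    unfolding cmod_power2 by (simp add: omega_def power2_eq_square field_simps)
  finally have "norm p = norm r"
    by (simp add: power2_eq_iff_nonneg)
  then have "dist A B = dist A C"
    by (simp add: p_def r_def dist_norm norm_minus_commute)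
  then show ?thesis
    using assms(1) not_collinear_iff unfolding isosceles_def by blast
qed

lemma exists_equivalent_isosceles:
  assumes "is_triangle \<Delta>"
  shows "\<exists>\<Delta>'. isosceles \<Delta>' \<and> equisectionally_equivalent \<Delta> \<Delta>'"
proof -
  obtain A B C where \<Delta>: "\<Delta> = {A, B, C}" and abc: "anticlockwise A B C"
    using assms is_triangle_iff by blast
  \<comment> \<open>The factor of \<open>T\<^sub>q\<close> is a positive multiple of the square of
    \<open>twist q\<close>, so it is compared with a square root of the distortion.\<close>
  define s where "s = csqrt (distortion A B C)"
  \<comment> \<open>This makes \<open>twist q\<close> a real multiple of \<open>cnj s\<close>. If \<open>Re s = 0\<close>, then
    \<open>u = 0\<close> by convention, which is right because \<open>s\<^sup>2\<close> is already real.\<close>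
  define u where "u = Im s / Re s"
  \<comment> \<open>Solves sqrt 3 (2 q - 1) = -u.\<close>
  define q where "q = (1 - u / sqrt 3) / 2"
  have twist: "twist q = Complex 1 (- u)"
    by (simp add: twist_def q_def field_simps)
  have "Im ((twist q)\<^sup>2 * s\<^sup>2) = 0"
    by (cases "Re s = 0") (simp_all add: twist u_def power2_eq_square field_simps)
  moreover have "twist q / cnj (twist q) * s\<^sup>2 = (twist q)\<^sup>2 * s\<^sup>2 / of_real ((norm (twist q))\<^sup>2)"
    using twist_nonzero[of q] unfolding complex_norm_square by (simp add: power2_eq_square)
  ultimately have "Im (twist q / cnj (twist q) * s\<^sup>2) = 0"
    by (metis Im_divide_of_real div_0)
  then have "Im (twist q / cnj (twist q) * distortion A B C) = 0"
    by (simp add: s_def)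
  then have "isosceles (equisect q \<Delta>)"
    unfolding \<Delta> equisect_eq[OF abc]
    by (intro isosceles_if_distortion_real equisect_anticlockwise abc)
      (simp only: distortion_equisect)
  then show ?thesis
    using equisectionally_equivalent_equisect assms by blast
qed

section \<open>Base angles and shapes of isosceles triangles\<close>

lemma isosceles_imp_triangle: "isosceles \<Delta> \<Longrightarrow> is_triangle \<Delta>"
  unfolding isosceles_def is_triangle_def by blast

lemma isosceles_has_base_angle: "isosceles \<Delta> \<Longrightarrow> \<exists>\<theta>. base_angle \<Delta> \<theta>"
  unfolding isosceles_def base_angle_def by blast

text \<open>With the midpoint of the base as origin and half the base as unit, the apex is
  equidistant from -1 and 1, hence purely imaginary. The number t is the signed ratio of height to
  half base.\<close>

lemma apex_form:
  fixes A B C :: complex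
  assumes "dist A B = dist A C" "B \<noteq> C"
  obtains t where "A = (B + C) / 2 + \<i> * of_real t * ((C - B) / 2)"
proof -
  define m d where "m = (B + C) / 2" and "d = (C - B) / 2"
  define z where "z = (A - m) / d"
  have "d \<noteq> 0"
    using assms by (simp add: d_def)
  then have zd: "A = m + z * d"
    by (simp add: z_def)
  moreover have "B = m - d" "C = m + d"
    by (simp_all add: m_def d_def field_simps)
  ultimately have "A - B = (z + 1) * d" "A - C = (z - 1) * d"
    by algebra+
  then have "(norm (z + 1))\<^sup>2 = (norm (z - 1))\<^sup>2"
    using assms(1) \<open>d \<noteq> 0\<close> by (simp add: dist_norm norm_mult)
  then have "Re z = 0"
    unfolding cmod_power2 by (simp add: power2_eq_square algebra_simps)
  then have "z = \<i> * of_real (Im z)"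
    by (simp add: complex_eq_iff)
  then show thesis
    using that zd unfolding m_def d_def by metis
qed

text \<open>Both base angles are covered because passing to an anticlockwise listing may exchange B
  and C.\<close>

lemma vertex_angle_apex_form:
  assumes "B \<noteq> C" "A = (B + C) / 2 + \<i> * of_real t * ((C - B) / 2)"
  shows "vertex_angle A B C = arccos (1 / sqrt (1 + t\<^sup>2))"
    and "vertex_angle A C B = arccos (1 / sqrt (1 + t\<^sup>2))"
proof -
  define m d where "m = (B + C) / 2" and "d = (C - B) / 2"
  have "d \<noteq> 0"
    using assms by (simp add: d_def)
  have "B = m - d" "C = m + d"
    by (simp_all add: m_def d_def field_simps)
  then have d: "A - B = Complex 1 t * d" "C - B = 2 * d"
    "A - C = Complex 1 (- t) * (- d)" "B - C = 2 * (- d)"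
    using assms(2)[folded m_def d_def] unfolding Complex_eq of_real_1 of_real_minus by algebra+
  \<comment> \<open>Used at B with (t, d) and at C with (-t, -d).\<close>
  have ip: "(Complex 1 x * e) \<bullet> (2 * e) / (norm (Complex 1 x * e) * norm (2 * e)) = 1 / sqrt (1 + x\<^sup>2)"
    if "e \<noteq> 0" for x e
  proof -
    have "(Complex 1 x * e) \<bullet> (2 * e) = 2 * (norm e)\<^sup>2"
      unfolding cmod_power2 by (simp add: inner_complex_def power2_eq_square algebra_simps)
    moreover have "norm (Complex 1 x * e) * norm (2 * e) = 2 * sqrt (1 + x\<^sup>2) * (norm e)\<^sup>2"
      by (simp add: norm_mult complex_norm power2_eq_square)
    ultimately show ?thesis
      using that by simp
  qed
  show "vertex_angle A B C = arccos (1 / sqrt (1 + t\<^sup>2))"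
    unfolding vertex_angle_def d using ip[of d t] \<open>d \<noteq> 0\<close> by simp
  show "vertex_angle A C B = arccos (1 / sqrt (1 + t\<^sup>2))"
    unfolding vertex_angle_def d using ip[of "- d" "- t"] \<open>d \<noteq> 0\<close> by simp
qed

lemma tan_arccos_inverse_hypotenuse:
  assumes "t \<ge> 0"
  shows "tan (arccos (1 / sqrt (1 + t\<^sup>2))) = t"
proof -
  have "1 / sqrt (1 + t\<^sup>2) = cos (arctan t)"
    by (simp add: cos_arctan)
  moreover have "0 \<le> arctan t" "arctan t \<le> pi"
    using assms arctan_ubound[of t] pi_gt_zero by (simp, linarith)
  ultimately show ?thesis
    by (simp add: arccos_cos tan_arctan)
qed

lemma shape_isosceles:
  assumes "base_angle \<Delta> \<theta>"
  shows "tan \<theta> > 0" "shape \<Delta> = of_real (((tan \<theta> - sqrt 3) / (tan \<theta> + sqrt 3)) ^ 3)"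
proof -
  have *: "tan \<theta> > 0 \<and> shape \<Delta> = of_real (((tan \<theta> - sqrt 3) / (tan \<theta> + sqrt 3)) ^ 3)"
    if \<Delta>: "\<Delta> = {A, B, C}" and abc: "anticlockwise A B C" and eq: "dist A B = dist A C"
      and \<theta>: "\<theta> = vertex_angle A B C \<or> \<theta> = vertex_angle A C B" for A B C
  proof -
    define d where "d = (C - B) / 2"
    have "B \<noteq> C"
      using abc anticlockwise_distinct by blast
    then obtain t where t: "A = (B + C) / 2 + \<i> * of_real t * ((C - B) / 2)"
      using eq apex_form by metis
    have "\<theta> = arccos (1 / sqrt (1 + t\<^sup>2))"
      using \<theta> vertex_angle_apex_form[OF \<open>B \<noteq> C\<close> t] by auto
    have "d \<noteq> 0"
      using \<open>B \<noteq> C\<close> by (simp add: d_def)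
    have "anticlockwise B C A"
      using abc anticlockwise_rotate by blast
    \<comment> \<open>The orientation puts the apex to the left of the directed base, which fixes
      the sign of t.\<close>
    moreover have "A - B = Complex 1 t / 2 * (C - B)"
      unfolding t by (simp add: Complex_eq field_simps)
    then have "(A - B) / (C - B) = Complex 1 t / 2"
      using \<open>B \<noteq> C\<close> by simp
    ultimately have "t > 0"
      by (simp add: anticlockwise_def)
    then have tan: "tan \<theta> = t"
      using \<open>\<theta> = _\<close> by (simp add: tan_arccos_inverse_hypotenuse)
    have i3: "omega\<^sup>2 - omega = - (\<i> * of_real (sqrt 3))"
      by (simp only: omega_square) (simp add: omega_def complex_eq_iff)
    \<comment> \<open>The midpoint is the constant mode and drops out; the base contributes opposite
      amounts to the two coefficients.\<close>
    have "neg_coeff A B C = \<i> * of_real t * d + (omega\<^sup>2 - omega) * d"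
      "pos_coeff A B C = \<i> * of_real t * d - (omega\<^sup>2 - omega) * d"
      unfolding neg_coeff_def pos_coeff_def t d_def omega_square by (simp_all add: field_simps)
    then have "neg_coeff A B C = of_real (t - sqrt 3) * (\<i> * d)"
      "pos_coeff A B C = of_real (t + sqrt 3) * (\<i> * d)"
      unfolding i3 by (simp_all add: algebra_simps)
    then have "distortion A B C = of_real ((t - sqrt 3) / (t + sqrt 3))"
      using \<open>d \<noteq> 0\<close> by (simp add: distortion_def)
    then show ?thesis
      unfolding \<Delta> shape_eq[OF abc] tan using \<open>t > 0\<close> by simp
  qed
  obtain A B C where \<Delta>: "\<Delta> = {A, B, C}" "\<Delta> = {A, C, B}" and nc: "\<not> collinear {A, B, C}"
    and eq: "dist A B = dist A C" and \<theta>: "\<theta> = vertex_angle A B C"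
    using assms unfolding base_angle_def by (metis insert_commute)
  have "tan \<theta> > 0 \<and> shape \<Delta> = of_real (((tan \<theta> - sqrt 3) / (tan \<theta> + sqrt 3)) ^ 3)"
    using nc not_collinear_iff *[OF \<Delta>(1)] *[OF \<Delta>(2)] eq \<theta> by metis
  then show "tan \<theta> > 0" "shape \<Delta> = of_real (((tan \<theta> - sqrt 3) / (tan \<theta> + sqrt 3)) ^ 3)"
    by auto
qed

text \<open>Cubing is injective on the reals, so the cubes can be removed; cross-multiplying then
  cancels all terms linear in t and t'.\<close>

lemma cube_opposite_iff:
  fixes t t' :: real
  assumes "t > 0" "t' > 0"
  shows "((t' - sqrt 3) / (t' + sqrt 3)) ^ 3 = - (((t - sqrt 3) / (t + sqrt 3)) ^ 3) \<longleftrightarrow> t * t' = 3"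
proof -
  have pos: "t + sqrt 3 > 0" "t' + sqrt 3 > 0"
    using assms by (simp_all add: add_pos_pos)
  have opp: "(sqrt 3 - t) / (t + sqrt 3) = - ((t - sqrt 3) / (t + sqrt 3))"
    by (simp add: minus_divide_left)
  have "((t' - sqrt 3) / (t' + sqrt 3)) ^ 3 = - (((t - sqrt 3) / (t + sqrt 3)) ^ 3)
      \<longleftrightarrow> ((t' - sqrt 3) / (t' + sqrt 3)) ^ 3 = ((sqrt 3 - t) / (t + sqrt 3)) ^ 3"
    unfolding opp by simp
  also have "\<dots> \<longleftrightarrow> (t' - sqrt 3) / (t' + sqrt 3) = (sqrt 3 - t) / (t + sqrt 3)"
    using odd_real_root_power_cancel[of 3] by (metis odd_numeral)
  also have "\<dots> \<longleftrightarrow> (t' - sqrt 3) * (t + sqrt 3) = (sqrt 3 - t) * (t' + sqrt 3)"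
    using pos by (simp add: frac_eq_eq)
  also have "\<dots> \<longleftrightarrow> t * t' = 3"
    by (auto simp: algebra_simps)
  finally show ?thesis .
qed

section \<open>The three claims\<close>

theorem proposition5:
  shows
    "(\<forall>\<Delta> \<Delta>' \<theta> \<theta>'.
        isosceles \<Delta> \<and> isosceles \<Delta>' \<and> base_angle \<Delta> \<theta> \<and> base_angle \<Delta>' \<theta>' \<longrightarrow>
          (equisectionally_equivalent \<Delta> \<Delta>' \<longleftrightarrow> similar \<Delta> \<Delta>' \<or> tan \<theta> * tan \<theta>' = 3)) \<and>
     (\<forall>\<Delta> \<Delta>'.
        isosceles \<Delta> \<and> isosceles \<Delta>' \<and> equisectionally_equivalent \<Delta> \<Delta>' \<and>
        sim_class \<Delta> \<noteq> sim_class \<Delta>' \<longrightarrow>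
          (\<forall>q :: real. sim_class (equisect q \<Delta>) = sim_class \<Delta>' \<longleftrightarrow> q = 1/3 \<or> q = 2/3)) \<and>
     (\<forall>\<Delta>. is_triangle \<Delta> \<longrightarrow> (\<exists>\<Delta>'. isosceles \<Delta>' \<and> equisectionally_equivalent \<Delta> \<Delta>'))"
proof (intro conjI allI impI; (elim conjE)?)
  fix \<Delta> \<Delta>' \<theta> \<theta>'
  assume iso: "isosceles \<Delta>" "isosceles \<Delta>'" and ba: "base_angle \<Delta> \<theta>" "base_angle \<Delta>' \<theta>'"
  note tri = iso[THEN isosceles_imp_triangle]
  note shapes = ba[THEN shape_isosceles(2)]
  have opposite: "shape \<Delta>' = - shape \<Delta> \<longleftrightarrow> tan \<theta> * tan \<theta>' = 3"
    using cube_opposite_iff[OF ba[THEN shape_isosceles(1)]] unfolding shapes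
    by (simp flip: of_real_minus add: of_real_eq_iff del: of_real_power of_real_divide)
  show "equisectionally_equivalent \<Delta> \<Delta>' \<longleftrightarrow> similar \<Delta> \<Delta>' \<or> tan \<theta> * tan \<theta>' = 3"
  proof
    assume "equisectionally_equivalent \<Delta> \<Delta>'"
    then have "norm (shape \<Delta>) = norm (shape \<Delta>')"
      by (rule norm_shape_invariant)
    moreover obtain x y where xy: "shape \<Delta> = of_real x" "shape \<Delta>' = of_real y"
      using shapes by blast
    \<comment> \<open>Both shapes are real, so equal moduli leave only equality or opposite
      signs.\<close>
    ultimately have "x = y \<or> y = - x"
      by auto
    then have "shape \<Delta> = shape \<Delta>' \<or> shape \<Delta>' = - shape \<Delta>"
      by (auto simp: xy)
    then show "similar \<Delta> \<Delta>' \<or> tan \<theta> * tan \<theta>' = 3"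
      using opposite tri by (simp add: similar_iff_shape)
  next
    assume "similar \<Delta> \<Delta>' \<or> tan \<theta> * tan \<theta>' = 3"
    then show "equisectionally_equivalent \<Delta> \<Delta>'"
    proof
      assume "similar \<Delta> \<Delta>'"
      then show ?thesis
        using tri equisectionally_equivalent_similar by blast
    next
      assume "tan \<theta> * tan \<theta>' = 3"
      \<comment> \<open>At q = 1/3 the operator negates the shape.\<close>
      then have "shape (equisect (1/3) \<Delta>) = shape \<Delta>'"
        using opposite tri twist_ratio_cube_eq_minus_one[of "1/3"] by (simp add: shape_equisect)
      then have "similar (equisect (1/3) \<Delta>) \<Delta>'"
        using tri by (simp add: similar_iff_shape is_triangle_equisect)
      then show ?thesis
        using tri equisectionally_equivalent_similar equisectionally_equivalent_equisect
          equisectionally_equivalent_trans is_triangle_equisect by blast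
    qed
  qed
next
  fix \<Delta> \<Delta>' q
  assume iso: "isosceles \<Delta>" "isosceles \<Delta>'"
    and equiv: "equisectionally_equivalent \<Delta> \<Delta>'" and ne: "sim_class \<Delta> \<noteq> sim_class \<Delta>'"
  note tri = iso[THEN isosceles_imp_triangle]
  obtain x y where xy: "shape \<Delta> = of_real x" "shape \<Delta>' = of_real y"
    using iso isosceles_has_base_angle shape_isosceles(2) by meson
  have "x \<noteq> y"
    using ne tri xy by (simp add: sim_class_eq_iff_shape)
  moreover have "\<bar>x\<bar> = \<bar>y\<bar>"
    using norm_shape_invariant[OF equiv] by (simp add: xy)
  \<comment> \<open>Dissimilarity excludes the regular triangle, whose shape is 0; this allows
    cancelling x below.\<close>
  ultimately have "y = - x" "x \<noteq> 0"
    by auto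
  then have "shape (equisect q \<Delta>) = shape \<Delta>' \<longleftrightarrow> (twist q / cnj (twist q)) ^ 3 * of_real x = -1 * of_real x"
    using tri by (simp add: shape_equisect xy)
  also have "\<dots> \<longleftrightarrow> q = 1/3 \<or> q = 2/3"
    using \<open>x \<noteq> 0\<close> unfolding mult_cancel_right by (simp only: twist_ratio_cube_eq_minus_one of_real_eq_0_iff simp_thms)
  finally show "sim_class (equisect q \<Delta>) = sim_class \<Delta>' \<longleftrightarrow> q = 1/3 \<or> q = 2/3"
    using tri by (simp add: sim_class_eq_iff_shape is_triangle_equisect)
qed (rule exists_equivalent_isosceles)

end
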